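(* For every integer $k \geq 1$ and every vertex $v$ of the Andrásfai graph $\operatorname{And}(k)$, both $\operatorname{And}(k)$ and $\operatorname{And}(k)-v$ are critical.
   Context: Graphs are finite and simple (loops and parallel edges produced by edge contraction are discarded). A labeling of a graph $G$ assigns a positive integer to each vertex. A labeling is feasible if every path between two distinct vertices with the same label contains a vertex having a higher label. The tree-depth $\operatorname{td}(G)$ is the smallest $m$ for which $G$ has a feasible labeling with labels from $\{1,\dots,m\}$ (the graph with no vertices has tree-depth 0). A graph $G$ is critical if every proper minor of $G$ has tree-depth strictly less than $\operatorname{td}(G)$. For a positive integer $k$, the Andrásfai graph $\operatorname{And}(k)$ has vertex set $\{0,1,\dots,3k-2\}$, and vertices $i>j$ are adjacent if and only if $i-j\equiv 1 \pmod 3$. $\operatorname{And}(k)-v$ is the graph obtained by deleting the vertex $v$; since $\operatorname{And}(k)$ is vertex-transitive, it is independent of $v$ up to isomorphism. *)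

theory Defs
  imports "Graph_Theory.Graph_Theory"
begin

text \<open>
  Finite simple graphs are the graphs \<^term>\<open>G\<close> with \<^prop>\<open>pair_graph G\<close>: an undirected edge
  between u and v is represented by the two arcs (u, v) and (v, u).
\<close>

definition labeling :: "'a pair_pre_digraph \<Rightarrow> ('a \<Rightarrow> nat) \<Rightarrow> bool" where
  "labeling G f \<longleftrightarrow> (\<forall>v \<in> pverts G. 0 < f v)"

definition feasible :: "'a pair_pre_digraph \<Rightarrow> ('a \<Rightarrow> nat) \<Rightarrow> bool" where
  "feasible G f \<longleftrightarrow>
    (\<forall>u \<in> pverts G. \<forall>v \<in> pverts G. u \<noteq> v \<and> f u = f v \<longrightarrow>
      (\<forall>p. vpath p (with_proj G) \<and> hd p = u \<and> last p = v \<longrightarrow>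
        (\<exists>w \<in> set p. f u < f w)))"

definition tree_depth :: "'a pair_pre_digraph \<Rightarrow> nat" where
  "tree_depth G =
    (LEAST m. \<exists>f. labeling G f \<and> feasible G f \<and> f ` pverts G \<subseteq> {1..m})"

definition delete_vertex :: "'a pair_pre_digraph \<Rightarrow> 'a \<Rightarrow> 'a pair_pre_digraph" where
  "delete_vertex G v =
    \<lparr> pverts = pverts G - {v},
      parcs = {(x, y) \<in> parcs G. x \<noteq> v \<and> y \<noteq> v} \<rparr>"

definition delete_edge :: "'a pair_pre_digraph \<Rightarrow> 'a \<Rightarrow> 'a \<Rightarrow> 'a pair_pre_digraph" where
  "delete_edge G u v =
    \<lparr> pverts = pverts G, parcs = parcs G - {(u, v), (v, u)} \<rparr>"

text \<open>
  Contracting the edge uv identifies v with u; the merged vertex keeps the name u. Arcs are pairs,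
  so parallel edges disappear by themselves, while loops are discarded explicitly.
\<close>

definition contract_edge :: "'a pair_pre_digraph \<Rightarrow> 'a \<Rightarrow> 'a \<Rightarrow> 'a pair_pre_digraph" where
  "contract_edge G u v =
    (let r = (\<lambda>x. if x = v then u else x) in
      \<lparr> pverts = pverts G - {v},
        parcs = {(r x, r y) | x y. (x, y) \<in> parcs G \<and> r x \<noteq> r y} \<rparr>)"

inductive minor_step :: "'a pair_pre_digraph \<Rightarrow> 'a pair_pre_digraph \<Rightarrow> bool"
  for G :: "'a pair_pre_digraph" where
  del_vertex: "v \<in> pverts G \<Longrightarrow> minor_step G (delete_vertex G v)"
| del_edge: "(u, v) \<in> parcs G \<Longrightarrow> minor_step G (delete_edge G u v)"
| contract: "(u, v) \<in> parcs G \<Longrightarrow> minor_step G (contract_edge G u v)"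

text \<open>
  Every operation decreases the number of vertices plus edges, so the proper minors of a finite
  graph are the graphs reached by at least one operation. They are taken on the vertex type of
  the graph itself: every proper minor is isomorphic to one of these, and tree-depth does not
  depend on the names of the vertices.
\<close>

definition proper_minor :: "'a pair_pre_digraph \<Rightarrow> 'a pair_pre_digraph \<Rightarrow> bool" where
  "proper_minor H G \<longleftrightarrow> minor_step\<^sup>+\<^sup>+ G H"

definition critical :: "'a pair_pre_digraph \<Rightarrow> bool" where
  "critical G \<longleftrightarrow>
    pair_graph G \<and> (\<forall>H. proper_minor H G \<longrightarrow> tree_depth H < tree_depth G)"

definition andrasfai :: "nat \<Rightarrow> nat pair_pre_digraph" where
  "andrasfai k =
    \<lparr> pverts = {0..3 * k - 2},
      parcs = {(i, j). i \<in> {0..3 * k - 2} \<and> j \<in> {0..3 * k - 2} \<and>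
        (j < i \<and> (i - j) mod 3 = 1 \<or> i < j \<and> (j - i) mod 3 = 1)} \<rparr>"

lemma pair_graph_iff:
  "pair_graph G \<longleftrightarrow> finite (pverts G) \<and> parcs G \<subseteq> pverts G \<times> pverts G \<and> sym (parcs G) \<and>
    irrefl (parcs G)"
  (is "?L \<longleftrightarrow> ?R")
proof
  assume ?L
  then interpret pair_graph G .
  show ?R
    using pair_finite_verts arc_fst_in_verts arc_snd_in_verts no_loops' arcs_symmetric
    by (fastforce simp: sym_def irrefl_def)
next
  assume r: ?R
  then have "finite (parcs G)"
    by (meson finite_SigmaI finite_subset)
  with r show ?L
    by unfold_locales (auto simp: symmetric_def irrefl_def)
qed

lemma pair_graph_andrasfai: "pair_graph (andrasfai k)"
  by (auto simp: pair_graph_iff andrasfai_def sym_def irrefl_def)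

lemma pair_graph_contract_edge:
  assumes "pair_graph G" "(u, v) \<in> parcs G"
  shows "pair_graph (contract_edge G u v)"
proof -
  have G: "finite (pverts G)" "parcs G \<subseteq> pverts G \<times> pverts G" "sym (parcs G)" "irrefl (parcs G)"
    using assms(1) by (simp_all add: pair_graph_iff)
  have uv: "u \<in> pverts G" "u \<noteq> v"
    using G(2,4) assms(2) by (auto simp: irrefl_def)
  define r where "r x = (if x = v then u else x)" for x
  have H: "contract_edge G u v =
      \<lparr> pverts = pverts G - {v}, parcs = {(r x, r y) | x y. (x, y) \<in> parcs G \<and> r x \<noteq> r y} \<rparr>"
    by (simp add: contract_edge_def r_def[abs_def] Let_def)
  have r: "r x \<in> pverts G - {v}" if "x \<in> pverts G" for x
    using that uv by (simp add: r_def)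
  have "parcs (contract_edge G u v) \<subseteq> (pverts G - {v}) \<times> (pverts G - {v})"
    unfolding H using G(2) r by fastforce
  moreover have "sym (parcs (contract_edge G u v))"
  proof (rule symI)
    fix a b assume "(a, b) \<in> parcs (contract_edge G u v)"
    then obtain x y where "a = r x" "b = r y" "(x, y) \<in> parcs G" "r x \<noteq> r y"
      unfolding H by auto
    moreover have "(y, x) \<in> parcs G"
      using G(3) \<open>(x, y) \<in> parcs G\<close> by (rule symD)
    ultimately show "(b, a) \<in> parcs (contract_edge G u v)"
      unfolding H by simp metis
  qed
  moreover have "irrefl (parcs (contract_edge G u v))"
    unfolding H irrefl_def by auto
  ultimately show ?thesis
    using G(1) by (simp add: pair_graph_iff H)
qed

lemma pair_graph_minor_step:
  assumes "minor_step G H" "pair_graph G"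
  shows "pair_graph H"
  using assms
proof cases
  case (contract u v)
  with assms(2) show ?thesis by (simp add: pair_graph_contract_edge)
qed (auto simp: pair_graph_iff delete_vertex_def delete_edge_def sym_def irrefl_def)

lemma pair_graph_proper_minor:
  assumes "proper_minor H G" "pair_graph G"
  shows "pair_graph H"
  using assms unfolding proper_minor_def
  by (induction rule: tranclp_induct) (auto intro: pair_graph_minor_step)

lemma tree_depth_attained:
  assumes "finite (pverts G)"
  shows "\<exists>f. labeling G f \<and> feasible G f \<and> f ` pverts G \<subseteq> {1..tree_depth G}"
proof -
  obtain h :: "'a \<Rightarrow> nat" and n where h: "h ` pverts G = {i. i < n}" "inj_on h (pverts G)"
    using finite_imp_inj_to_nat_seg[OF assms] by blast
  let ?f = "\<lambda>v. Suc (h v)"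
  have "labeling G ?f" "feasible G ?f"
    using h(2) by (auto simp: labeling_def feasible_def inj_on_def)
  moreover have "?f ` pverts G \<subseteq> {1..n}"
    using h(1) by (fastforce simp: Suc_le_eq)
  ultimately have "\<exists>f. labeling G f \<and> feasible G f \<and> f ` pverts G \<subseteq> {1..n}"
    by blast
  then show ?thesis
    unfolding tree_depth_def by (rule LeastI)
qed

end

theory Submission
  imports Defs
begin

text \<open>
  Multiplication by k modulo n = 3 k - 1 turns the graph And(k) into the circulant graph on n points
  of a circle in which two points are adjacent iff their circular distance is at least k. Its
  independence number is k, and two anticomplete vertex sets that both contain an edge have at most
  k + 1 elements together. These two facts show that every induced subgraph with s vertices has
  tree-depth at least s - k + 1, so that And(k) has tree-depth at least 2 k, and And(k) - v at least
  2 k - 1.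

  For a minor obtained by one operation it suffices to find a set S avoiding v whose size exceeds
  the tree-depth of the subgraph on S by one more than is possible in And(k) itself (or the same,
  if a vertex has been lost), since the remaining vertices can be removed one at a time. Place the
  affected edge at positions 0 and t, with v outside the arc between them. If t = k, the whole arc
  with the two ends is independent after the deletion or contraction. If t > k, contraction leaves
  the independent arc from 1 to k, while deletion separates position 0 together with the arc from
  t - k to t into two stars.
\<close>

section \<open>Tree-depth by elimination\<close>

text \<open>The recursive description of tree-depth as an upper bound: removing a vertex costs one
  level, splitting into anticomplete parts costs nothing. The parts need not be connected, and
  \<open>E\<close> is not restricted to \<open>S\<close>, so one relation serves all induced
  subgraphs.\<close>

inductive td_le :: "('a \<times> 'a) set \<Rightarrow> nat \<Rightarrow> 'a set \<Rightarrow> bool" for E where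
  empty: "td_le E m {}"
| insert: "td_le E m S \<Longrightarrow> td_le E (Suc m) (insert w S)"
| union: "td_le E m A \<Longrightarrow> td_le E m B \<Longrightarrow> A \<inter> B = {} \<Longrightarrow> E \<inter> (A \<times> B \<union> B \<times> A) = {} \<Longrightarrow>
    td_le E m (A \<union> B)"

lemma td_le_finite: "td_le E m S \<Longrightarrow> finite S"
  by (induction rule: td_le.induct) auto

lemma td_le_Suc: "td_le E m S \<Longrightarrow> td_le E (Suc m) S"
  by (induction rule: td_le.induct) (auto intro: td_le.intros)

text \<open>The same elimination works on \<open>T\<close>; a step that removes a vertex outside
  \<open>T\<close> is left idle. Comparing \<open>E'\<close> with \<open>E\<close> only inside
  \<open>T\<close> covers vertex and edge deletions at once.\<close>

lemma td_le_subset: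
  assumes "td_le E m S" "T \<subseteq> S" "E' \<inter> T \<times> T \<subseteq> E"
  shows "td_le E' m T"
  using assms
proof (induction arbitrary: T rule: td_le.induct)
  case (empty m)
  then show ?case by (auto intro: td_le.empty)
next
  case (insert m S w)
  have *: "td_le E' m (T - {w})"
    using insert.prems by (intro insert.IH) auto
  show ?case
  proof (cases "w \<in> T")
    case True
    then show ?thesis using td_le.insert[OF *, of w] by (simp add: insert_absorb)
  next
    case False
    then show ?thesis using td_le_Suc[OF *] by simp
  qed
next
  case (union m A B)
  have "td_le E' m (T \<inter> A \<union> T \<inter> B)"
    using union.prems union.hyps by (intro td_le.union union.IH) auto
  moreover have "T \<inter> A \<union> T \<inter> B = T"
    using union.prems by auto
  ultimately show ?case by simp
qed

lemma td_le_add: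
  assumes "finite T" "td_le E m S"
  shows "td_le E (m + card T) (S \<union> T)"
  using assms
proof (induction T rule: finite_induct)
  case (insert x F)
  then show ?case using td_le.insert[of E "m + card F" "S \<union> F" x] by simp
qed simp

text \<open>The vertices outside \<open>S\<close> are removed first, at one level each. The count is
  written additively to avoid truncated subtraction.\<close>

lemma td_le_extend:
  assumes "td_le E j S" "S \<subseteq> V" "finite V" "card V + j \<le> m + card S"
  shows "td_le E m V"
proof -
  have "td_le E (j + card (V - S)) (S \<union> (V - S))"
    using assms by (intro td_le_add) auto
  moreover have "S \<union> (V - S) = V" using assms(2) by auto
  ultimately have V: "td_le E (j + card (V - S)) V" by simp
  have "card (V - S) = card V - card S" "card S \<le> card V"
    using assms td_le_finite by (auto intro: card_Diff_subset card_mono finite_subset)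
  then have "j + card (V - S) \<le> m" using assms(4) by linarith
  then obtain d where "m = j + card (V - S) + d" using le_Suc_ex by blast
  moreover have "td_le E (j + card (V - S) + d) V"
    by (induction d) (auto intro: V td_le_Suc)
  ultimately show ?thesis by simp
qed

lemma td_le_independent:
  assumes "finite S" "E \<inter> S \<times> S = {}"
  shows "td_le E 1 S"
  using assms
proof (induction S rule: finite_induct)
  case (insert x F)
  have "td_le E 1 ({x} \<union> F)"
    using insert td_le.insert[OF td_le.empty, of E 0 x] by (intro td_le.union) auto
  then show ?case by simp
qed (rule td_le.empty)

text \<open>The elimination of \<open>S\<close> is followed until \<open>u\<close> or
  \<open>v\<close> is removed; at that moment the merged vertex is removed instead. Until then no
  union step separates \<open>u\<close> from \<open>v\<close>, because they are adjacent.\<close>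

lemma td_le_contract:
  assumes "td_le E m S" "u \<in> S" "v \<in> S" "(u, v) \<in> E" "u \<noteq> v"
    and r: "r = (\<lambda>x. if x = v then u else x)"
  shows "td_le {(r x, r y) | x y. (x, y) \<in> E \<and> r x \<noteq> r y} m (S - {v})"
    (is "td_le ?E m _")
  using assms(1-3)
proof (induction rule: td_le.induct)
  case (empty m)
  then show ?case by simp
next
  case (insert m S w)
  \<comment> \<open>Away from \<open>u\<close> and \<open>v\<close> the contraction changes no
    arc.\<close>
  have *: "td_le ?E m (S - {u, v})"
    using insert.hyps by (rule td_le_subset) (auto simp: r split: if_splits)
  show ?case
  proof (cases "w \<in> {u, v}")
    case True
    have "insert w S - {v} = insert u (S - {u, v})"
      using True insert.prems \<open>u \<noteq> v\<close> by auto
    then show ?thesis using td_le.insert[OF *, of u] by simp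
  next
    case False
    then have "td_le ?E (Suc m) (insert w (S - {v}))"
      using insert by (intro td_le.insert) auto
    then show ?thesis using False by (simp add: insert_Diff_if)
  qed
next
  case (union m A B)
  have side: "td_le ?E m (C - {v})"
    if "td_le E m C" "u \<in> C \<Longrightarrow> v \<in> C \<Longrightarrow> td_le ?E m (C - {v})" "u \<in> C \<longleftrightarrow> v \<in> C" for C
  proof (cases "u \<in> C")
    case False
    then show ?thesis using that(1,3)
      by (intro td_le_subset[OF that(1)]) (auto simp: r split: if_splits)
  qed (use that in auto)
  have iff: "u \<in> A \<longleftrightarrow> v \<in> A" "u \<in> B \<longleftrightarrow> v \<in> B"
    using union.prems union.hyps \<open>(u, v) \<in> E\<close> by auto
  have "td_le ?E m (A - {v})" "td_le ?E m (B - {v})"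
    using side[OF union.hyps(1) union.IH(1) iff(1)] side[OF union.hyps(2) union.IH(2) iff(2)]
    by auto
  moreover have "?E \<inter> ((A - {v}) \<times> (B - {v}) \<union> (B - {v}) \<times> (A - {v})) = {}"
  proof -
    have "(r x, r y) \<notin> (A - {v}) \<times> (B - {v}) \<union> (B - {v}) \<times> (A - {v})" if "(x, y) \<in> E" for x y
      using that iff union.hyps by (auto simp: r)
    then show ?thesis by blast
  qed
  ultimately have "td_le ?E m ((A - {v}) \<union> (B - {v}))"
    using union.hyps by (intro td_le.union) auto
  then show ?case by (simp add: Un_Diff)
qed

lemma td_le_minor_step:
  assumes "minor_step G H" "pair_graph G" "td_le (parcs G) m (pverts G)"
  shows "td_le (parcs H) m (pverts H)"
  using assms(1)
proof cases
  case (contract u v)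
  then have "u \<in> pverts G" "v \<in> pverts G" "u \<noteq> v"
    using assms(2) by (auto simp: pair_graph_iff irrefl_def)
  then show ?thesis
    using td_le_contract[OF assms(3), of u v] contract by (simp add: contract_edge_def Let_def)
qed (auto simp: delete_vertex_def delete_edge_def intro: td_le_subset[OF assms(3)])

section \<open>Elimination and feasible labelings\<close>

definition low_arcs :: "('a \<times> 'a) set \<Rightarrow> 'a set \<Rightarrow> ('a \<Rightarrow> nat) \<Rightarrow> nat \<Rightarrow> ('a \<times> 'a) set" where
  "low_arcs E S f c = {(x, y) \<in> E. x \<in> S \<and> y \<in> S \<and> f x \<le> c \<and> f y \<le> c}"

text \<open>Feasibility with reachability in place of paths: a path from \<open>u\<close> without a
  label above \<open>f u\<close> exists exactly when \<open>low_arcs\<close> at level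
  \<open>f u\<close> connects its ends. Separating \<open>E\<close> from \<open>S\<close> matches
  \<open>td_le\<close> and permits induction on \<open>S\<close>.\<close>

definition feasible_on :: "('a \<times> 'a) set \<Rightarrow> 'a set \<Rightarrow> ('a \<Rightarrow> nat) \<Rightarrow> bool" where
  "feasible_on E S f \<longleftrightarrow>
    (\<forall>u\<in>S. \<forall>v\<in>S. u \<noteq> v \<and> f u = f v \<longrightarrow> (u, v) \<notin> (low_arcs E S f (f u))\<^sup>*)"

text \<open>A chain of low arcs is a walk, and shortening a walk to a path only drops vertices, so
  the bound on the labels survives.\<close>

lemma low_path_iff:
  assumes "u \<in> pverts G" "f u \<le> c"
  shows "(u, v) \<in> (low_arcs (parcs G) (pverts G) f c)\<^sup>* \<longleftrightarrow>
    (\<exists>p. vpath p (with_proj G) \<and> hd p = u \<and> last p = v \<and> (\<forall>w\<in>set p. f w \<le> c))"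
    (is "?L \<longleftrightarrow> ?R")
proof
  assume ?L
  then have "\<exists>p. vwalk p (with_proj G) \<and> hd p = u \<and> last p = v \<and> (\<forall>w\<in>set p. f w \<le> c)"
    using assms
  proof (induction rule: converse_rtrancl_induct)
    case base
    then show ?case by (intro exI[of _ "[v]"]) (auto simp: vwalk_def)
  next
    case (step u x)
    then obtain p where "vwalk p (with_proj G)" "hd p = x" "last p = v" "\<forall>w\<in>set p. f w \<le> c"
      by (auto simp: low_arcs_def)
    then show ?case using step.hyps step.prems
      by (intro exI[of _ "u # p"]) (auto simp: low_arcs_def intro!: vwalk_consI)
  qed
  then obtain p where p: "vwalk p (with_proj G)" "hd p = u" "last p = v" "\<forall>w\<in>set p. f w \<le> c"
    by blast
  then have "p \<noteq> []" by auto
  with p show ?R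
    using vwalk_to_vpath_vpath[OF p(1)] vwalk_to_vpath_hd[of p] vwalk_to_vpath_last[of p]
      vwalk_to_vpath_subset[of _ p]
    by (intro exI[of _ "vwalk_to_vpath p"]) auto
next
  assume ?R
  then obtain p where p: "vwalk p (with_proj G)" "hd p = u" "last p = v" "\<forall>w\<in>set p. f w \<le> c"
    by auto
  then show ?L
  proof (induction p arbitrary: u rule: list.induct)
    case Nil
    then show ?case by auto
  next
    case (Cons x p)
    show ?case
    proof (cases p)
      case Nil
      then show ?thesis using Cons.prems by simp
    next
      case (Cons y q)
      then have "(y, v) \<in> (low_arcs (parcs G) (pverts G) f c)\<^sup>*"
        using Cons.prems by (intro Cons.IH) (auto simp: vwalk_def)
      moreover have "(u, y) \<in> low_arcs (parcs G) (pverts G) f c"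
        using Cons.prems Cons by (auto simp: vwalk_def low_arcs_def)
      ultimately show ?thesis by (meson converse_rtrancl_into_rtrancl)
    qed
  qed
qed

lemma feasible_iff_feasible_on: "feasible G f \<longleftrightarrow> feasible_on (parcs G) (pverts G) f"
proof -
  have "(u, v) \<notin> (low_arcs (parcs G) (pverts G) f (f u))\<^sup>* \<longleftrightarrow>
    (\<forall>p. vpath p (with_proj G) \<and> hd p = u \<and> last p = v \<longrightarrow> (\<exists>w\<in>set p. f u < f w))"
    if "u \<in> pverts G" for u v
    using low_path_iff[of u G f "f u" v] that by (auto simp: not_le)
  then show ?thesis
    unfolding feasible_def feasible_on_def by blast
qed

lemma feasible_on_subset:
  assumes "feasible_on E S f" "T \<subseteq> S"
  shows "feasible_on E T f"
proof -
  have "low_arcs E T f c \<subseteq> low_arcs E S f c" for c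
    using assms(2) by (auto simp: low_arcs_def)
  then have "(low_arcs E T f c)\<^sup>* \<subseteq> (low_arcs E S f c)\<^sup>*" for c
    by (rule rtrancl_mono)
  then show ?thesis
    using assms unfolding feasible_on_def by blast
qed

text \<open>Two vertices with the top label must lie in different components, which gives a union
  step. If at most one vertex has the top label, removing it lowers the range of labels.\<close>

lemma feasible_on_imp_td_le:
  assumes "finite S" "sym E" "feasible_on E S f" "f ` S \<subseteq> {1..m}"
  shows "td_le E m S"
  using assms(1,3,4)
proof (induction "card S" arbitrary: S m rule: less_induct)
  case less
  show ?case
  proof (cases "S = {}")
    case True
    then show ?thesis by (simp add: td_le.empty)
  next
    case False
    with less.prems obtain n where m: "m = Suc n"
      by (cases m) auto
    show ?thesis
    proof (cases "\<exists>a\<in>S. \<exists>b\<in>S. a \<noteq> b \<and> f a = m \<and> f b = m")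
      case True
      then obtain a b where ab: "a \<in> S" "b \<in> S" "a \<noteq> b" "f a = m" "f b = m"
        by blast
      \<comment> \<open>No label exceeds \<open>m\<close>, so at level \<open>m\<close> all arcs
        inside \<open>S\<close> are low and \<open>A\<close> is the component of
        \<open>a\<close>.\<close>
      define A where "A = {x \<in> S. (a, x) \<in> (low_arcs E S f m)\<^sup>*}"
      have le: "f x \<le> m" if "x \<in> S" for x
        using less.prems that by auto
      have "(a, b) \<notin> (low_arcs E S f (f a))\<^sup>*"
        using less.prems(2) ab unfolding feasible_on_def by metis
      then have "a \<in> A" "b \<in> S - A" "A \<subseteq> S"
        using ab by (auto simp: A_def)
      have "y \<in> A" if "x \<in> A" "y \<in> S" "(x, y) \<in> E" for x y
        using that le by (auto simp: A_def low_arcs_def intro: rtrancl_into_rtrancl)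
      then have "E \<inter> (A \<times> (S - A) \<union> (S - A) \<times> A) = {}"
        using \<open>sym E\<close> by (auto dest: symD)
      moreover have "f ` A \<subseteq> {1..m}" "f ` (S - A) \<subseteq> {1..m}"
        using less.prems(3) \<open>A \<subseteq> S\<close> by blast+
      then have "td_le E m A" "td_le E m (S - A)"
        using \<open>a \<in> A\<close> \<open>b \<in> S - A\<close> \<open>A \<subseteq> S\<close> less.prems
        by (auto intro!: less.hyps psubset_card_mono intro: finite_subset feasible_on_subset)
      ultimately have "td_le E m (A \<union> (S - A))"
        by (intro td_le.union) auto
      then show ?thesis using \<open>A \<subseteq> S\<close> by (simp add: Un_absorb1)
    next
      case False
      \<comment> \<open>The only vertex labeled \<open>m\<close>, or an arbitrary one if there is
        none.\<close>
      obtain w where w: "w \<in> S" "\<forall>x\<in>S - {w}. f x \<noteq> m"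
        using False \<open>S \<noteq> {}\<close> by blast
      have "td_le E n (S - {w})"
      proof (rule less.hyps)
        show "f ` (S - {w}) \<subseteq> {1..n}"
          using w less.prems(3) m by (force simp: le_Suc_eq)
        show "card (S - {w}) < card S"
          using w less.prems(1) by (intro card_Diff1_less)
      qed (use less.prems in \<open>auto intro: feasible_on_subset\<close>)
      then have "td_le E m (insert w (S - {w}))"
        unfolding m by (rule td_le.insert)
      then show ?thesis using w by (simp add: insert_absorb)
    qed
  qed
qed

text \<open>\<open>A\<close> is a region that low arcs cannot leave and on which both labelings
  agree, so reachability carries over to the other labeling and vertex set.\<close>

lemma low_path_stays:
  assumes "(x, y) \<in> (low_arcs E S f c)\<^sup>*" "x \<in> A"
    and "\<And>x y. (x, y) \<in> E \<Longrightarrow> x \<in> A \<Longrightarrow> y \<in> S \<Longrightarrow> f y \<le> c \<Longrightarrow> y \<in> A"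
    and "\<And>x. x \<in> A \<Longrightarrow> x \<in> S \<Longrightarrow> x \<in> T \<and> g x = f x"
  shows "(x, y) \<in> (low_arcs E T g c)\<^sup>* \<and> y \<in> A"
  using assms(1,2)
proof (induction rule: rtrancl_induct)
  case (step y z)
  then have "(y, z) \<in> low_arcs E T g c" "z \<in> A"
    using assms(3,4) by (auto simp: low_arcs_def)
  then show ?case using step by auto
qed simp

text \<open>A removed vertex receives a label above all others and so blocks every low path; the
  labelings of anticomplete parts can be merged freely.\<close>

lemma td_le_imp_feasible_on:
  assumes "td_le E m S"
  shows "\<exists>f. feasible_on E S f \<and> f ` S \<subseteq> {1..m}"
  using assms
proof (induction rule: td_le.induct)
  case (empty m)
  then show ?case by (simp add: feasible_on_def)
next
  case (insert m S w)
  then obtain f where f: "feasible_on E S f" "f ` S \<subseteq> {1..m}" by blast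
  define g where "g = f(w := Suc m)"
  have "(u, v) \<notin> (low_arcs E (insert w S) g (g u))\<^sup>*"
    if "u \<in> insert w S" "v \<in> insert w S" "u \<noteq> v" "g u = g v" for u v
  proof
    assume *: "(u, v) \<in> (low_arcs E (insert w S) g (g u))\<^sup>*"
    have le: "f x \<le> m" if "x \<in> S" for x using f(2) that by auto
    have uv: "u \<in> S - {w}" "v \<in> S - {w}"
      using that le[of u] le[of v] by (auto simp: g_def split: if_splits)
    then have "g u \<le> m" using le by (simp add: g_def)
    have "(u, v) \<in> (low_arcs E S f (g u))\<^sup>* \<and> v \<in> S - {w}"
      using uv \<open>g u \<le> m\<close> by (intro low_path_stays[OF *]) (auto simp: g_def split: if_splits)
    then show False using f(1) uv that by (auto simp: g_def feasible_on_def)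
  qed
  moreover have "g ` insert w S \<subseteq> {1..Suc m}"
    using f(2) by (auto simp: g_def)
  ultimately show ?case by (auto simp: feasible_on_def)
next
  case (union m A B)
  then obtain f g where f: "feasible_on E A f" "f ` A \<subseteq> {1..m}"
    and g: "feasible_on E B g" "g ` B \<subseteq> {1..m}" by blast
  define h where "h x = (if x \<in> A then f x else g x)" for x
  have "(u, v) \<notin> (low_arcs E (A \<union> B) h (h u))\<^sup>*"
    if "u \<in> A \<union> B" "v \<in> A \<union> B" "u \<noteq> v" "h u = h v" for u v
  proof
    assume *: "(u, v) \<in> (low_arcs E (A \<union> B) h (h u))\<^sup>*"
    show False
    proof (cases "u \<in> A")
      case True
      have "(u, v) \<in> (low_arcs E A f (h u))\<^sup>* \<and> v \<in> A"
        using True union.hyps by (intro low_path_stays[OF *]) (auto simp: h_def)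
      then show False using f(1) True that by (auto simp: h_def feasible_on_def)
    next
      case False
      then have "u \<in> B" using that by auto
      have "(u, v) \<in> (low_arcs E B g (h u))\<^sup>* \<and> v \<in> B"
        using \<open>u \<in> B\<close> union.hyps by (intro low_path_stays[OF *]) (auto simp: h_def)
      moreover have "v \<notin> A" using calculation union.hyps by auto
      ultimately show False using g(1) False \<open>u \<in> B\<close> that by (auto simp: h_def feasible_on_def)
    qed
  qed
  moreover have "h ` (A \<union> B) \<subseteq> {1..m}"
    using f(2) g(2) by (auto simp: h_def)
  ultimately show ?case by (auto simp: feasible_on_def)
qed

lemma tree_depth_le_iff:
  assumes "pair_graph G"
  shows "tree_depth G \<le> m \<longleftrightarrow> td_le (parcs G) m (pverts G)"
proof
  assume le: "tree_depth G \<le> m"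
  obtain f where "feasible G f" "f ` pverts G \<subseteq> {1..tree_depth G}"
    using tree_depth_attained[of G] assms by (auto simp: pair_graph_iff)
  then show "td_le (parcs G) m (pverts G)"
    using assms le
    by (intro feasible_on_imp_td_le[of _ _ f]) (auto simp: pair_graph_iff feasible_iff_feasible_on)
next
  assume "td_le (parcs G) m (pverts G)"
  then obtain f where f: "feasible G f" "f ` pverts G \<subseteq> {1..m}"
    using td_le_imp_feasible_on[of "parcs G" m "pverts G"] by (auto simp: feasible_iff_feasible_on)
  then have "labeling G f" by (force simp: labeling_def)
  with f show "tree_depth G \<le> m"
    unfolding tree_depth_def by (intro Least_le) blast
qed

text \<open>Minor operations preserve the bound \<open>m\<close>, so only minors obtained by a
  single operation need to be examined.\<close>

lemma criticalI:
  assumes "pair_graph G" "\<not> td_le (parcs G) m (pverts G)"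
    and "\<And>H. minor_step G H \<Longrightarrow> td_le (parcs H) m (pverts H)"
  shows "critical G"
proof -
  have "pair_graph H \<and> td_le (parcs H) m (pverts H)" if "minor_step\<^sup>+\<^sup>+ G H" for H
    using that
  proof (induction rule: tranclp_induct)
    case (base H)
    then show ?case using assms by (auto intro: pair_graph_minor_step)
  next
    case (step H K)
    then show ?case by (auto intro: pair_graph_minor_step td_le_minor_step)
  qed
  then have "tree_depth H \<le> m" if "minor_step\<^sup>+\<^sup>+ G H" for H
    using that tree_depth_le_iff by blast
  moreover have "m < tree_depth G"
    using assms(1,2) tree_depth_le_iff by (meson not_le)
  ultimately show ?thesis
    using assms(1) by (fastforce simp: critical_def proper_minor_def)
qed

section \<open>The circular model of the Andrasfai graph\<close>

text \<open>Adjacency of the positions i and j on a circle with 3 k - 1 points: both arcs between them have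
  length at least k.\<close>

definition circ :: "nat \<Rightarrow> nat \<Rightarrow> nat \<Rightarrow> bool" where
  "circ k i j \<longleftrightarrow> i + k \<le> j \<and> j < i + 2 * k \<or> j + k \<le> i \<and> i < j + 2 * k"

text \<open>An isomorphism onto the circular model, left variable so that a rotation can place any
  chosen vertex at position 0.\<close>

definition coords :: "nat \<Rightarrow> (nat \<Rightarrow> nat) \<Rightarrow> bool" where
  "coords k p \<longleftrightarrow>
    bij_betw p (pverts (andrasfai k)) {..<3 * k - 1} \<and>
    (\<forall>x \<in> pverts (andrasfai k). \<forall>y \<in> pverts (andrasfai k).
      (x, y) \<in> parcs (andrasfai k) \<longleftrightarrow> circ k (p x) (p y))"

lemma pverts_andrasfai: "k \<ge> 1 \<Longrightarrow> pverts (andrasfai k) = {..<3 * k - 1}"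
  by (auto simp: andrasfai_def)

lemma circ_sym: "circ k i j \<longleftrightarrow> circ k j i"
  by (auto simp: circ_def)

lemma mod_add_cases:
  fixes i c n :: nat
  assumes "i < n" "c < n"
  shows "(i + c) mod n = (if i + c < n then i + c else i + c - n)"
  using assms by (simp add: mod_if)

lemma bij_betw_lessThanI:
  fixes p :: "nat \<Rightarrow> nat"
  assumes "\<And>x y. x < n \<Longrightarrow> y < n \<Longrightarrow> x < y \<Longrightarrow> p x \<noteq> p y" "\<And>x. x < n \<Longrightarrow> p x < n"
  shows "bij_betw p {..<n} {..<n}"
proof -
  have "inj_on p {..<n}"
    using assms(1) by (metis inj_onI lessThan_iff linorder_neqE_nat)
  moreover have "p ` {..<n} = {..<n}"
    using calculation assms(2) by (intro endo_inj_surj) auto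
  ultimately show ?thesis by (simp add: bij_betw_def)
qed

text \<open>Since 3 k is 1 modulo 3 k - 1, multiplication by k turns the residue class 1 modulo 3 of the
  vertex difference into the interval from k to 2 k - 1.\<close>

lemma multiplied_difference:
  fixes x y k :: nat
  assumes "y < x" "x < 3 * k - 1"
  obtains e where "0 < e" "e < 3 * k - 1"
    "(k * x) mod (3 * k - 1) = ((k * y) mod (3 * k - 1) + e) mod (3 * k - 1)"
    "(x - y) mod 3 = 1 \<longleftrightarrow> k \<le> e \<and> e < 2 * k"
proof
  \<comment> \<open>The witness is \<open>q + k * r\<close>, since k (3 q + r) = 3 k q + k r is
    congruent to q + k r. The residues r = 0, 1, 2 put it below k, in the interval from k to 2 k -
    1, and from 2 k on, respectively.\<close>
  define q r where "q = (x - y) div 3" and "r = (x - y) mod 3"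
  define n where "n = 3 * k - 1"
  have k: "1 \<le> k" using assms by linarith
  have x: "x = y + 3 * q + r" and "r < 3"
    using assms by (simp_all add: q_def r_def)
  then consider "r = 0" | "r = 1" | "r = 2" by linarith
  then have "0 < q + k * r \<and> q + k * r < 3 * k - 1 \<and>
      (r = 1 \<longleftrightarrow> k \<le> q + k * r \<and> q + k * r < 2 * k)"
    using assms x k by cases auto
  then show "0 < q + k * r" "q + k * r < 3 * k - 1"
      "(x - y) mod 3 = 1 \<longleftrightarrow> k \<le> q + k * r \<and> q + k * r < 2 * k"
    by (simp_all add: r_def)
  have "3 * k = n + 1" using k by (simp add: n_def)
  then have "3 * k * q = n * q + q" by (simp add: algebra_simps)
  moreover have "k * x = k * y + 3 * k * q + k * r" using x by (simp add: algebra_simps)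
  ultimately have "k * x = k * y + (q + k * r) + n * q" by linarith
  then show "(k * x) mod (3 * k - 1) = ((k * y) mod (3 * k - 1) + (q + k * r)) mod (3 * k - 1)"
    unfolding n_def[symmetric] by (simp add: mod_add_left_eq)
qed

text \<open>The interval from k to 2 k - 1 is invariant under negation modulo 3 k - 1, so it does
  not matter whether adding \<open>e\<close> wraps around the circle.\<close>

lemma coords_multiply:
  assumes "k \<ge> 1"
  shows "coords k (\<lambda>x. (k * x) mod (3 * k - 1))"
proof -
  let ?p = "\<lambda>x. (k * x) mod (3 * k - 1)"
  have *: "?p y \<noteq> ?p x \<and> ((x - y) mod 3 = 1 \<longleftrightarrow> circ k (?p x) (?p y))"
    if xy: "y < x" "x < 3 * k - 1" for x y
  proof -
    obtain e where e: "0 < e" "e < 3 * k - 1" "?p x = (?p y + e) mod (3 * k - 1)"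
      "(x - y) mod 3 = 1 \<longleftrightarrow> k \<le> e \<and> e < 2 * k"
      by (rule multiplied_difference[OF xy])
    have "?p y < 3 * k - 1" using assms by simp
    then show ?thesis
      unfolding e(3,4) mod_add_cases[OF \<open>?p y < 3 * k - 1\<close> e(2)] using e(1,2)
      by (auto simp: circ_def)
  qed
  have "bij_betw ?p {..<3 * k - 1} {..<3 * k - 1}"
    using * assms by (intro bij_betw_lessThanI) auto
  moreover have "(x, y) \<in> parcs (andrasfai k) \<longleftrightarrow> circ k (?p x) (?p y)"
    if "x < 3 * k - 1" "y < 3 * k - 1" for x y
  proof (cases x y rule: linorder_cases)
    case less
    then show ?thesis using *[OF less that(2)] that by (auto simp: andrasfai_def circ_sym)
  next
    case equal
    then show ?thesis using assms by (auto simp: andrasfai_def circ_def)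
  next
    case greater
    then show ?thesis using *[OF greater that(1)] that by (auto simp: andrasfai_def)
  qed
  ultimately show ?thesis
    by (simp add: coords_def pverts_andrasfai[OF assms])
qed

text \<open>Rotation by \<open>c\<close> with at most one wrap, stated without \<open>mod\<close>.
  Used for \<open>c\<close> and for \<open>n - c\<close>, it yields both directions of the
  invariance of \<open>circ\<close>.\<close>

lemma circ_wrap:
  assumes "circ k i j" "i' = i + c \<or> i' + n = i + c" "j' = j + c \<or> j' + n = j + c"
    "i' < n" "j' < n" "n + 1 = 3 * k"
  shows "circ k i' j'"
  using assms(2,3)
proof (elim disjE)
  assume "i' = i + c" "j' = j + c"
  then show ?thesis using assms(1) by (simp add: circ_def)
next
  assume "i' = i + c" "j' + n = j + c"
  then show ?thesis using assms(1,4-6) unfolding circ_def by linarith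
next
  assume "i' + n = i + c" "j' = j + c"
  then show ?thesis using assms(1,4-6) unfolding circ_def by linarith
next
  assume "i' + n = i + c" "j' + n = j + c"
  then show ?thesis using assms(1) unfolding circ_def by linarith
qed

lemma coords_shift:
  assumes "coords k p" "k \<ge> 1" "c < 3 * k - 1"
  shows "coords k (\<lambda>x. (p x + c) mod (3 * k - 1))"
proof -
  define n where "n = 3 * k - 1"
  have "bij_betw (\<lambda>i. (i + c) mod n) {..<n} {..<n}"
    using assms(3) by (intro bij_betw_lessThanI) (auto simp: n_def mod_add_cases)
  then have "bij_betw ((\<lambda>i. (i + c) mod n) \<circ> p) (pverts (andrasfai k)) {..<n}"
    using assms(1) by (intro bij_betw_trans) (auto simp: coords_def n_def)
  moreover have "circ k ((i + c) mod n) ((j + c) mod n) \<longleftrightarrow> circ k i j" if "i < n" "j < n" for i j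
  proof -
    have wrap: "(l + c) mod n = l + c \<or> (l + c) mod n + n = l + c" if "l < n" for l
      using that assms(3) by (simp add: mod_add_cases n_def)
    have unwrap: "l = (l + c) mod n + (n - c) \<or> l + n = (l + c) mod n + (n - c)" if "l < n" for l
      using wrap[OF that] assms(3) unfolding n_def[symmetric] by linarith
    have n: "n + 1 = 3 * k" "0 < n" using assms(2) by (simp_all add: n_def)
    then have less: "(l + c) mod n < n" for l by simp
    show ?thesis
      using circ_wrap[OF _ wrap[OF that(1)] wrap[OF that(2)] less less n(1)]
        circ_wrap[OF _ unwrap[OF that(1)] unwrap[OF that(2)] that n(1)] by blast
  qed
  moreover have "p x < n" if "x \<in> pverts (andrasfai k)" for x
    using that assms(1) by (auto simp: coords_def n_def bij_betw_def)
  ultimately show ?thesis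
    using assms(1) by (simp add: coords_def n_def comp_def)
qed

lemma coords_less: "coords k p \<Longrightarrow> x \<in> pverts (andrasfai k) \<Longrightarrow> p x < 3 * k - 1"
  by (auto simp: coords_def bij_betw_def)

lemma coords_inj: "coords k p \<Longrightarrow> inj_on p (pverts (andrasfai k))"
  by (auto simp: coords_def bij_betw_def)

lemma coords_arc:
  assumes "coords k p" "x \<in> pverts (andrasfai k)" "y \<in> pverts (andrasfai k)"
  shows "(x, y) \<in> parcs (andrasfai k) \<longleftrightarrow> circ k (p x) (p y)"
  using assms by (auto simp: coords_def)

lemma coords_card:
  assumes "coords k p" "J \<subseteq> {..<3 * k - 1}"
  shows "card {x \<in> pverts (andrasfai k). p x \<in> J} = card J"
proof -
  have "p ` {x \<in> pverts (andrasfai k). p x \<in> J} = J"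
    using assms by (auto simp: coords_def bij_betw_def)
  moreover have "inj_on p {x \<in> pverts (andrasfai k). p x \<in> J}"
    using coords_inj[OF assms(1)] by (rule inj_on_subset) auto
  ultimately show ?thesis using card_image by metis
qed

lemma coords_at:
  assumes "k \<ge> 1" "a \<in> pverts (andrasfai k)"
  obtains p where "coords k p" "p a = 0"
proof -
  define n where "n = 3 * k - 1"
  define p where "p x = (k * x) mod n" for x
  have p: "coords k p"
    using coords_multiply[OF assms(1)] by (simp add: p_def[abs_def] n_def)
  have "p a < n" using coords_less[OF p assms(2)] by (simp add: n_def)
  show ?thesis
  proof (rule that)
    \<comment> \<open>The inner \<open>mod\<close> handles \<open>p a = 0\<close>, where
      \<open>n - p a\<close> is not an admissible shift.\<close>
    show "coords k (\<lambda>x. (p x + (n - p a) mod n) mod (3 * k - 1))"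
      using assms \<open>p a < n\<close> by (intro coords_shift[OF p]) (auto simp: n_def)
    show "(p a + (n - p a) mod n) mod (3 * k - 1) = 0"
      using \<open>p a < n\<close> unfolding n_def[symmetric] by (simp add: mod_add_right_eq)
  qed
qed

text \<open>If \<open>v\<close> lies strictly between the two ends, rotating the other end to 0 puts
  \<open>v\<close> outside the arc from 0 to the first end. Hence \<open>x\<close> and
  \<open>y\<close> may be \<open>a\<close> and \<open>b\<close> in either order.\<close>

lemma coords_edge:
  assumes "k \<ge> 1" "(a, b) \<in> parcs (andrasfai k)" "v \<in> pverts (andrasfai k)"
  obtains p x y where "coords k p" "x = a \<and> y = b \<or> x = b \<and> y = a"
    "p x = 0" "k \<le> p y" "p y < 2 * k" "p v = 0 \<or> p y \<le> p v"
proof -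
  have ab: "a \<in> pverts (andrasfai k)" "b \<in> pverts (andrasfai k)"
    using pair_graph_andrasfai[of k] assms(2) by (auto simp: pair_graph_iff)
  obtain p where p: "coords k p" "p a = 0" using coords_at[OF assms(1) ab(1)] .
  have "circ k 0 (p b)" using coords_arc[OF p(1) ab] assms(2) p(2) by simp
  then have b: "k \<le> p b" "p b < 2 * k" using assms(1) by (auto simp: circ_def)
  show ?thesis
  proof (cases "p v = 0 \<or> p b \<le> p v")
    case True
    then show ?thesis using that[of p a b] p b by auto
  next
    case False
    define q where "q x = (p x + (3 * k - 1 - p b)) mod (3 * k - 1)" for x
    have "coords k q"
      unfolding q_def[abs_def] using b by (intro coords_shift[OF p(1)]) (use assms(1) in auto)
    moreover have "q b = 0" "q a = 3 * k - 1 - p b" "q v = p v + (3 * k - 1 - p b)"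
      using False p(2) b assms(1) coords_less[OF p(1) ab(2)] by (auto simp: q_def)
    ultimately show ?thesis using that[of q b a] b by auto
  qed
qed

section \<open>The lower bound\<close>

text \<open>Nonadjacency to 0 leaves the positions below k and those from 2 k on. Shifting the
  latter down by 2 k - 1 puts everything below k, and a collision would be a pair at the forbidden
  distance 2 k - 1.\<close>

lemma circ_independent_card:
  assumes "J \<subseteq> {..<3 * k - 1}" "0 \<in> J" "\<And>i j. i \<in> J \<Longrightarrow> j \<in> J \<Longrightarrow> \<not> circ k i j"
  shows "card J \<le> k"
proof -
  let ?g = "\<lambda>i. if i < k then i else i + 1 - 2 * k"
  have J: "i < k \<or> 2 * k \<le> i \<and> i < 3 * k - 1" if "i \<in> J" for i
    using assms(1) assms(3)[OF assms(2) that] that by (auto simp: circ_def)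
  have "0 < k" using assms(1,2) by (cases k) auto
  have "inj_on ?g J"
  proof (rule inj_onI)
    fix i j assume ij: "i \<in> J" "j \<in> J" "?g i = ?g j"
    then show "i = j"
      using J[OF ij(1)] J[OF ij(2)] assms(3)[OF ij(1,2)]
      by (auto simp: circ_def split: if_splits)
  qed
  moreover have "?g ` J \<subseteq> {..<k}"
  proof
    fix l assume "l \<in> ?g ` J"
    then obtain i where "i \<in> J" "l = ?g i" by blast
    then show "l \<in> {..<k}" using J[of i] by auto
  qed
  ultimately have "card J \<le> card {..<k}"
    by (rule card_inj_on_le) simp
  then show ?thesis by simp
qed

text \<open>An edge splits the circle into two arcs, and the vertices adjacent to neither end form an
  independent set in each arc. So the two anticomplete sets occupy four alternating intervals of
  the circle, whose total length is forced to be small.\<close>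

lemma circ_anticomplete_card:
  assumes "A \<subseteq> {..<3 * k - 1}" "B \<subseteq> {..<3 * k - 1}"
    and A: "0 \<in> A" "t \<in> A" "circ k 0 t"
    and B: "c \<in> B" "d \<in> B" "circ k c d"
    and AB: "\<And>x y. x \<in> A \<Longrightarrow> y \<in> B \<Longrightarrow> \<not> circ k x y"
  shows "card A + card B \<le> k + 1"
proof -
  have "0 < k" using assms(1) A by (cases k) auto
  with A(3) have t: "k \<le> t" "t < 2 * k" by (auto simp: circ_def)
  have Bx: "t < x + k \<and> x < k \<or> 2 * k \<le> x \<and> x < t + k" if "x \<in> B" for x
    using AB[OF A(1) that] AB[OF A(2) that] assms(2) that t by (auto simp: circ_def)
  define B1 B2 where "B1 = {x \<in> B. x < k}" and "B2 = {x \<in> B. 2 * k \<le> x}"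
  have "finite B" using assms(2) finite_subset by blast
  then have fin: "finite B1" "finite B2"
    by (auto simp: B1_def B2_def)
  \<comment> \<open>Two positions in the same interval differ by less than k, so the edge from
    \<open>c\<close> to \<open>d\<close> needs one end in each.\<close>
  have "B1 \<noteq> {}" "B2 \<noteq> {}"
    using B Bx[OF B(1)] Bx[OF B(2)] t by (auto simp: B1_def B2_def circ_def)
  define p1 q1 p2 q2 where "p1 = Min B1" and "q1 = Max B1" and "p2 = Min B2" and "q2 = Max B2"
  have mem: "p1 \<in> B1" "q1 \<in> B1" "p2 \<in> B2" "q2 \<in> B2"
    using fin \<open>B1 \<noteq> {}\<close> \<open>B2 \<noteq> {}\<close> by (auto simp: p1_def q1_def p2_def q2_def)
  then have inB: "p1 \<in> B" "q1 \<in> B" "p2 \<in> B" "q2 \<in> B"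
    by (auto simp: B1_def B2_def)
  have p1: "t < p1 + k" "p1 \<le> q1" "q1 < k" and p2: "2 * k \<le> p2" "p2 \<le> q2" "q2 < t + k"
    using mem Bx[OF inB(1)] Bx[OF inB(4)] fin t
    by (auto simp: B1_def B2_def p1_def q1_def p2_def q2_def)
  have "B \<subseteq> {p1..q1} \<union> {p2..q2}"
  proof
    fix x assume "x \<in> B"
    then have "x \<in> B1 \<or> x \<in> B2" using Bx by (auto simp: B1_def B2_def)
    then show "x \<in> {p1..q1} \<union> {p2..q2}"
      using fin by (auto simp: p1_def q1_def p2_def q2_def)
  qed
  then have "card B \<le> card ({p1..q1} \<union> {p2..q2})" by (intro card_mono) auto
  also have "\<dots> \<le> (q1 + 1 - p1) + (q2 + 1 - p2)"
    by (rule order_trans[OF card_Un_le]) simp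
  finally have cB: "card B \<le> (q1 + 1 - p1) + (q2 + 1 - p2)" .
  \<comment> \<open>Nonadjacency to the four extreme points of \<open>B\<close> confines
    \<open>A\<close> to the two complementary arcs; the one through 0 appears as two
    intervals.\<close>
  have "A \<subseteq> {q2 + 1 - k..<p1 + k} \<union> {..<p2 + 1 - 2 * k} \<union> {q1 + 2 * k..<3 * k - 1}"
  proof
    fix x assume x: "x \<in> A"
    have "x < 3 * k - 1" using x assms(1) by auto
    moreover have "\<not> circ k x p1" "\<not> circ k x q1" "\<not> circ k x p2" "\<not> circ k x q2"
      using AB[OF x] inB by auto
    ultimately have "q2 + 1 \<le> x + k \<and> x < p1 + k \<or> x + 2 * k < p2 + 1 \<or> q1 + 2 * k \<le> x"
      using p1 p2 t unfolding circ_def by linarith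
    then show "x \<in> {q2 + 1 - k..<p1 + k} \<union> {..<p2 + 1 - 2 * k} \<union> {q1 + 2 * k..<3 * k - 1}"
      using \<open>x < 3 * k - 1\<close> by auto
  qed
  then have "card A \<le> card ({q2 + 1 - k..<p1 + k} \<union> {..<p2 + 1 - 2 * k} \<union> {q1 + 2 * k..<3 * k - 1})"
    by (intro card_mono) auto
  also have "\<dots> \<le> card {q2 + 1 - k..<p1 + k} + card {..<p2 + 1 - 2 * k}
      + card {q1 + 2 * k..<3 * k - 1}"
    by (meson add_le_mono1 card_Un_le order_trans)
  finally have "card A \<le> (p1 + k - (q2 + 1 - k)) + (p2 + 1 - 2 * k) + (3 * k - 1 - (q1 + 2 * k))"
    by simp
  \<comment> \<open>These equations undo the truncated subtractions; in the sum of the two bounds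
    the extreme points cancel and k + 1 remains.\<close>
  moreover have "q2 + 1 - k + (p1 + k - (q2 + 1 - k)) = p1 + k" "q2 + 1 - k + k = q2 + 1"
    "p2 + 1 - 2 * k + 2 * k = p2 + 1" "3 * k - 1 - (q1 + 2 * k) + q1 + 1 = k"
    "q1 + 1 - p1 + p1 = q1 + 1" "q2 + 1 - p2 + p2 = q2 + 1"
    using p1 p2 t by linarith+
  ultimately show ?thesis using cB by linarith
qed

section \<open>Transfer to And(k) and the size bound for a given elimination depth\<close>

lemma andrasfai_independent_card:
  assumes "k \<ge> 1" "I \<subseteq> pverts (andrasfai k)" "parcs (andrasfai k) \<inter> I \<times> I = {}"
  shows "card I \<le> k"
proof (cases "I = {}")
  case False
  then obtain a where "a \<in> I" by blast
  then obtain p where p: "coords k p" "p a = 0"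
    using coords_at assms(1,2) by blast
  have arc: "\<not> circ k (p x) (p y)" if "x \<in> I" "y \<in> I" for x y
    using coords_arc[OF p(1), of x y] that assms(2,3) by auto
  have "0 \<in> p ` I" using \<open>a \<in> I\<close> p(2) by force
  then have "card (p ` I) \<le> k"
    using coords_less[OF p(1)] assms(2) arc by (intro circ_independent_card) auto
  moreover have "inj_on p I" using coords_inj[OF p(1)] assms(2) by (rule inj_on_subset)
  ultimately show ?thesis by (simp add: card_image)
qed simp

lemma andrasfai_anticomplete_card:
  assumes "k \<ge> 1" "A \<subseteq> pverts (andrasfai k)" "B \<subseteq> pverts (andrasfai k)"
    and "parcs (andrasfai k) \<inter> A \<times> A \<noteq> {}" "parcs (andrasfai k) \<inter> B \<times> B \<noteq> {}"
    and "parcs (andrasfai k) \<inter> A \<times> B = {}"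
  shows "card A + card B \<le> k + 1"
proof -
  obtain a b c d where a: "a \<in> A" "b \<in> A" "(a, b) \<in> parcs (andrasfai k)"
    and c: "c \<in> B" "d \<in> B" "(c, d) \<in> parcs (andrasfai k)"
    using assms(4,5) by auto
  obtain p where p: "coords k p" "p a = 0"
    using coords_at assms(1,2) a(1) by blast
  have arc: "(x, y) \<in> parcs (andrasfai k) \<longleftrightarrow> circ k (p x) (p y)"
    if "x \<in> A \<union> B" "y \<in> A \<union> B" for x y
    using coords_arc[OF p(1), of x y] that assms(2,3) by auto
  have "card (p ` A) + card (p ` B) \<le> k + 1"
  proof (rule circ_anticomplete_card)
    show "p ` A \<subseteq> {..<3 * k - 1}" "p ` B \<subseteq> {..<3 * k - 1}"
      using coords_less[OF p(1)] assms(2,3) by auto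
    show "0 \<in> p ` A" using a(1) p(2) by force
    show "p b \<in> p ` A" "p c \<in> p ` B" "p d \<in> p ` B" using a c by auto
    show "circ k 0 (p b)" using arc[of a b] a p(2) by simp
    show "circ k (p c) (p d)" using arc[of c d] c by simp
    show "\<not> circ k x y" if "x \<in> p ` A" "y \<in> p ` B" for x y
      using that arc assms(6) by fastforce
  qed
  moreover have "inj_on p A" "inj_on p B"
    using coords_inj[OF p(1)] assms(2,3) by (auto intro: inj_on_subset)
  ultimately show ?thesis by (simp add: card_image)
qed

lemma td_le_0: "td_le E m S \<Longrightarrow> m = 0 \<Longrightarrow> S = {}"
  by (induction rule: td_le.induct) auto

lemma td_le_arc:
  assumes "td_le E m S" "E \<inter> S \<times> S \<noteq> {}" "irrefl E"
  shows "2 \<le> m"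
  using assms
proof (induction rule: td_le.induct)
  case (insert m S w)
  then have "S \<noteq> {}" by (auto simp: irrefl_def)
  then have "m \<noteq> 0" using td_le_0 insert.hyps by metis
  then show ?case by simp
next
  case (union m A B)
  then have "E \<inter> A \<times> A \<noteq> {} \<or> E \<inter> B \<times> B \<noteq> {}" by blast
  then show ?case using union by blast
qed simp

text \<open>The induction needs the independent set I: it collects the edgeless sides of the unions, which
  do not contribute to the tree-depth.\<close>

lemma td_le_andrasfai_card:
  assumes "td_le (parcs (andrasfai k)) m S" "k \<ge> 1"
    and "S \<subseteq> pverts (andrasfai k)" "I \<subseteq> pverts (andrasfai k)"
    and "parcs (andrasfai k) \<inter> I \<times> I = {}"
    and "S \<inter> I = {}" "parcs (andrasfai k) \<inter> (S \<times> I \<union> I \<times> S) = {}"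
  shows "card S + card I + 1 \<le> max 1 m + k"
  using assms(1,3-7)
proof (induction arbitrary: I rule: td_le.induct)
  case (empty m)
  then show ?case using andrasfai_independent_card[OF assms(2), of I] by simp
next
  case (insert m S w)
  have fin: "finite S" using insert.hyps by (rule td_le_finite)
  show ?case
  \<comment> \<open>From \<open>m = 0\<close> to 1 the value \<open>max 1 m\<close> does not grow,
    so the induction hypothesis falls one short; the independence number is applied to
    \<open>I\<close> together with \<open>w\<close> instead.\<close>
  proof (cases "m = 0")
    case True
    then have S: "S = {}" using insert.hyps td_le_0 by metis
    have "finite I" using insert.prems(2) finite_subset by (auto simp: andrasfai_def)
    have irr: "(w, w) \<notin> parcs (andrasfai k)" by (auto simp: andrasfai_def)
    have "card (insert w I) \<le> k"
      using insert.prems irr S by (intro andrasfai_independent_card assms(2)) auto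
    then show ?thesis using \<open>finite I\<close> S insert.prems by simp
  next
    case False
    then have "card S + card I + 1 \<le> m + k"
      using insert.IH[of I] insert.prems by auto
    moreover have "card (insert w S) \<le> card S + 1"
      using fin by (simp add: card_insert_if)
    ultimately show ?thesis by simp
  qed
next
  case (union m A B)
  let ?E = "parcs (andrasfai k)"
  have fin: "finite A" "finite B" "finite I"
    using union.hyps td_le_finite finite_subset[OF union.prems(2)] by (auto simp: andrasfai_def)
  have card: "card (A \<union> B) = card A + card B" "card (B \<union> I) = card B + card I"
    "card (A \<union> I) = card A + card I"
    using fin union.hyps union.prems by (auto intro!: card_Un_disjoint)
  have E: "?E \<inter> A \<times> B = {}" "?E \<inter> B \<times> A = {}" "?E \<inter> I \<times> I = {}"
    "?E \<inter> A \<times> I = {}" "?E \<inter> I \<times> A = {}" "?E \<inter> B \<times> I = {}" "?E \<inter> I \<times> B = {}"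
    "A \<inter> B = {}" "B \<inter> A = {}" "A \<inter> I = {}" "B \<inter> I = {}"
    using union.hyps(3,4) union.prems(3-5)
    by (auto simp: Sigma_Un_distrib1 Sigma_Un_distrib2 Int_Un_distrib Int_Un_distrib2)
  consider "?E \<inter> B \<times> B = {}" | "?E \<inter> A \<times> A = {}"
    | "?E \<inter> A \<times> A \<noteq> {}" "?E \<inter> B \<times> B \<noteq> {}" by blast
  then show ?case
  proof cases
    case 1
    have "?E \<inter> (B \<union> I) \<times> (B \<union> I) = {}" "?E \<inter> (A \<times> (B \<union> I) \<union> (B \<union> I) \<times> A) = {}"
      "A \<inter> (B \<union> I) = {}"
      using 1 E by (simp_all add: Sigma_Un_distrib1 Sigma_Un_distrib2 Int_Un_distrib Int_Un_distrib2 Int_commute)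
    then have "card A + card (B \<union> I) + 1 \<le> max 1 m + k"
      using union.prems by (intro union.IH(1)) auto
    then show ?thesis by (simp add: card)
  next
    case 2
    have "?E \<inter> (A \<union> I) \<times> (A \<union> I) = {}" "?E \<inter> (B \<times> (A \<union> I) \<union> (A \<union> I) \<times> B) = {}"
      "B \<inter> (A \<union> I) = {}"
      using 2 E by (simp_all add: Sigma_Un_distrib1 Sigma_Un_distrib2 Int_Un_distrib Int_Un_distrib2 Int_commute)
    then have "card B + card (A \<union> I) + 1 \<le> max 1 m + k"
      using union.prems by (intro union.IH(2)) auto
    then show ?thesis by (simp add: card)
  next
    case 3
    \<comment> \<open>\<open>I\<close> joins \<open>B\<close>, which keeps the two sets
      anticomplete. The resulting bound k + 1 suffices because an edge inside \<open>A\<close>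
      forces \<open>m\<close> to be at least 2.\<close>
    have "?E \<inter> A \<times> (B \<union> I) = {}" "?E \<inter> (B \<union> I) \<times> (B \<union> I) \<noteq> {}"
      using 3(2) E by (auto simp: Sigma_Un_distrib1 Sigma_Un_distrib2 Int_Un_distrib Int_Un_distrib2)
    then have "card A + card (B \<union> I) \<le> k + 1"
      using 3(1) union.prems by (intro andrasfai_anticomplete_card assms(2)) auto
    moreover have "irrefl ?E" by (auto simp: irrefl_def andrasfai_def)
    then have "2 \<le> m" using td_le_arc union.hyps(1) 3(1) by blast
    ultimately show ?thesis by (simp add: card)
  qed
qed

section \<open>Upper bounds for the minors\<close>

text \<open>With \<open>v\<close> at 0, one of the arcs 1 to k and k + 1 to 2 k misses
  \<open>w\<close>, and k consecutive positions are independent. Removing the other 2 k - 3 vertices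
  first gives depth 2 k - 2. The second arc fits on the circle only for k at least 2.\<close>

lemma td_le_delete_two_vertices:
  assumes "k \<ge> 1" "v \<in> pverts (andrasfai k)" "w \<in> pverts (andrasfai k)" "v \<noteq> w"
  shows "td_le (parcs (andrasfai k)) (2 * k - 2) (pverts (andrasfai k) - {v, w})"
proof -
  let ?V = "pverts (andrasfai k)"
  have V: "finite ?V" "card ?V = 3 * k - 1"
    using pverts_andrasfai[OF assms(1)] by simp_all
  have card: "card (?V - {v, w}) = 3 * k - 3"
    using V assms by (simp add: card_Diff_subset)
  show ?thesis
  proof (cases "k = 1")
    case True
    then have "?V - {v, w} = {}" using card V(1) by simp
    then show ?thesis by (simp only: td_le.empty)
  next
    case False
    obtain p where p: "coords k p" "p v = 0" using coords_at assms(1,2) by blast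
    define J where "J = (if p w \<le> k then {k<..2 * k} else {0<..k})"
    define S where "S = {x \<in> ?V. p x \<in> J}"
    have "p w \<noteq> 0"
      using coords_inj[OF p(1)] p(2) assms(2-4) by (metis inj_onD)
    then have S: "S \<subseteq> ?V - {v, w}"
      using p(2) by (auto simp: S_def J_def split: if_splits)
    have "J \<subseteq> {..<3 * k - 1}" using assms(1) False by (auto simp: J_def)
    then have "card S = card J" unfolding S_def by (rule coords_card[OF p(1)])
    then have "card S = k" by (auto simp: J_def)
    have "(x, y) \<notin> parcs (andrasfai k)" if "x \<in> S" "y \<in> S" for x y
      using that coords_arc[OF p(1), of x y] by (auto simp: S_def J_def circ_def split: if_splits)
    moreover have "finite S" using V(1) by (simp add: S_def)
    ultimately have td: "td_le (parcs (andrasfai k)) 1 S"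
      by (intro td_le_independent) auto
    have "card (?V - {v, w}) + 1 \<le> 2 * k - 2 + card S"
      using card \<open>card S = k\<close> assms(1) by linarith
    then show ?thesis
      using V(1) by (intro td_le_extend[OF td S]) simp_all
  qed
qed

text \<open>In And(k) itself a nonempty set of k + j vertices has depth at least j + 1, so
  \<open>S\<close> gains one level. The condition on \<open>v\<close> makes \<open>S\<close> usable
  in And(k) - v, where \<open>v\<close> is not an end of the edge.\<close>

lemma td_le_delete_edge:
  assumes "k \<ge> 1" "(a, b) \<in> parcs (andrasfai k)" "v \<in> pverts (andrasfai k)"
  obtains j S where "td_le (parcs (andrasfai k) - {(a, b), (b, a)}) j S"
    "S \<subseteq> pverts (andrasfai k)" "v \<in> S \<Longrightarrow> v \<in> {a, b}" "card S = k + j"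
proof -
  let ?V = "pverts (andrasfai k)"
  define E where "E = parcs (andrasfai k) - {(a, b), (b, a)}"
  note that = that[folded E_def]
  have V: "finite ?V" using pverts_andrasfai[OF assms(1)] by simp
  obtain p x y where p: "coords k p" and xy: "x = a \<and> y = b \<or> x = b \<and> y = a"
    and y: "p x = 0" "k \<le> p y" "p y < 2 * k" and v: "p v = 0 \<or> p y \<le> p v"
    by (rule coords_edge[OF assms])
  have xV: "x \<in> ?V" "y \<in> ?V"
    using pair_graph_andrasfai[of k] assms(2) xy by (auto simp: pair_graph_iff)
  have inj: "p z = 0 \<longleftrightarrow> z = x" "p z = p y \<longleftrightarrow> z = y" if "z \<in> ?V" for z
    using coords_inj[OF p] that xV y(1) by (metis inj_onD)+
  have arcE: "circ k (p z) (p z') \<and> \<not> (p z = 0 \<and> p z' = p y) \<and> \<not> (p z = p y \<and> p z' = 0)"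
    if "z \<in> ?V" "z' \<in> ?V" "(z, z') \<in> E" for z z'
    using coords_arc[OF p that(1,2)] that(3) inj[OF that(1)] inj[OF that(2)] xy by (auto simp: E_def)
  define P where "P J = {z \<in> ?V. p z \<in> J}" for J
  have P: "finite (P J)" "P J \<subseteq> ?V" "z \<in> P J \<longleftrightarrow> z \<in> ?V \<and> p z \<in> J" for J z
    using V by (auto simp: P_def)
  \<comment> \<open>The hypothesis allows the deleted edge as the only pair in \<open>J\<close> at
    distance k or more.\<close>
  have indep: "td_le E 1 (P J)"
    if J: "\<And>i j. i \<in> J \<Longrightarrow> j \<in> J \<Longrightarrow> i + k \<le> j \<Longrightarrow> i = 0 \<and> j = p y" for J
  proof (rule td_le_independent)
    have "(z, z') \<notin> E" if "z \<in> P J" "z' \<in> P J" for z z'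
    proof
      assume "(z, z') \<in> E"
      moreover have z: "z \<in> ?V" "z' \<in> ?V" "p z \<in> J" "p z' \<in> J" using that P(3) by auto
      ultimately show False
        using arcE[of z z'] J[OF z(3,4)] J[OF z(4,3)] unfolding circ_def by blast
    qed
    then show "E \<inter> P J \<times> P J = {}" by blast
  qed (rule P)
  have vS: "v \<in> {a, b}" if "v \<in> P J" "J \<subseteq> {..p y}" for J
  proof -
    have "p v = 0 \<or> p v = p y" using that v by (auto simp: P_def)
    then show ?thesis using inj[OF assms(3)] xy by auto
  qed
  show ?thesis
  proof (cases "p y = k")
    case True
    have "td_le E 1 (P {..k})"
      using True by (intro indep) (auto simp: circ_def)
    moreover have "card (P {..k}) = k + 1"
      unfolding P_def using y by (subst coords_card[OF p]) (use coords_less[OF p xV(2)] True in auto)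
    ultimately show ?thesis
      using that[of 1 "P {..k}"] P(2) vS[of "{..k}"] True by simp
  next
    case False
    then have t: "k < p y" "p y < 2 * k" using y by auto
    \<comment> \<open>Removing \<open>x\<close> from \<open>X\<close>, or \<open>y\<close> from
      \<open>Y\<close>, leaves an independent set. The only edge of And(k) between the two sets was
      the deleted one, so both removals share a level.\<close>
    define X Y where "X = insert x (P {k..<p y})" and "Y = insert y (P {p y - k..<k})"
    have "td_le E (Suc 1) X"
      unfolding X_def using t by (intro td_le.insert indep) auto
    moreover have "td_le E (Suc 1) Y"
      unfolding Y_def using t by (intro td_le.insert indep) auto
    moreover have X: "z \<in> ?V \<and> (p z = 0 \<or> k \<le> p z \<and> p z < p y)" if "z \<in> X" for z
      using that xV y(1) by (auto simp: X_def P)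
    moreover have Y: "z \<in> ?V \<and> (p z = p y \<or> p y \<le> p z + k \<and> p z < k)" if "z \<in> Y" for z
      using that xV t by (auto simp: Y_def P)
    moreover have "X \<inter> Y = {}"
    proof -
      have False if "z \<in> X" "z \<in> Y" for z
        using X[OF that(1)] Y[OF that(2)] t by linarith
      then show ?thesis by blast
    qed
    moreover have "E \<inter> (X \<times> Y \<union> Y \<times> X) = {}"
    proof -
      have "(z, z') \<notin> E \<and> (z', z) \<notin> E" if "z \<in> X" "z' \<in> Y" for z z'
      proof -
        have "\<not> circ k (p z) (p z') \<or> p z = 0 \<and> p z' = p y"
          using X[OF that(1)] Y[OF that(2)] t unfolding circ_def by linarith
        then show ?thesis
          using arcE[of z z'] arcE[of z' z] X[OF that(1)] Y[OF that(2)] circ_sym by blast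
      qed
      then show ?thesis by blast
    qed
    ultimately have "td_le E (Suc 1) (X \<union> Y)"
      by (intro td_le.union)
    moreover have "X \<union> Y = P ({0} \<union> {p y - k..p y})"
    proof
      show "X \<union> Y \<subseteq> P ({0} \<union> {p y - k..p y})"
        using X Y t by (fastforce simp: P(3))
      show "P ({0} \<union> {p y - k..p y}) \<subseteq> X \<union> Y"
      proof
        fix z assume z: "z \<in> P ({0} \<union> {p y - k..p y})"
        then have "z \<in> ?V" by (simp add: P)
        show "z \<in> X \<union> Y"
          using z inj[OF \<open>z \<in> ?V\<close>] by (auto simp: X_def Y_def P(3))
      qed
    qed
    ultimately have "td_le E 2 (P ({0} \<union> {p y - k..p y}))"
      by (simp add: numeral_2_eq_2)
    moreover have "card (P ({0} \<union> {p y - k..p y})) = k + 2"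
    proof -
      have "{0} \<union> {p y - k..p y} \<subseteq> {..<3 * k - 1}" using coords_less[OF p xV(2)] by auto
      then have "card (P ({0} \<union> {p y - k..p y})) = card ({0} \<union> {p y - k..p y})"
        unfolding P_def by (rule coords_card[OF p])
      then show ?thesis using t by simp
    qed
    moreover have "v \<in> {a, b}" if "v \<in> P ({0} \<union> {p y - k..p y})"
      using that by (rule vS) auto
    ultimately show ?thesis
      using that P(2) by blast
  qed
qed

text \<open>Contraction already loses the vertex \<open>w\<close>, so an independent set of k
  vertices is enough to gain a level.\<close>

lemma td_le_contract_edge:
  assumes "k \<ge> 1" "(u, w) \<in> parcs (andrasfai k)" "v \<in> pverts (andrasfai k)"
  obtains S where "td_le (parcs (contract_edge (andrasfai k) u w)) 1 S"
    "S \<subseteq> pverts (andrasfai k) - {w}" "v \<in> S \<Longrightarrow> v = u" "card S = k"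
proof -
  let ?V = "pverts (andrasfai k)" and ?E = "parcs (contract_edge (andrasfai k) u w)"
  have V: "finite ?V" using pverts_andrasfai[OF assms(1)] by simp
  obtain p x y where p: "coords k p" and xy: "x = u \<and> y = w \<or> x = w \<and> y = u"
    and y: "p x = 0" "k \<le> p y" "p y < 2 * k" and v: "p v = 0 \<or> p y \<le> p v"
    by (rule coords_edge[OF assms])
  have xV: "x \<in> ?V" "y \<in> ?V"
    using pair_graph_andrasfai[of k] assms(2) xy by (auto simp: pair_graph_iff)
  define P where "P J = {z \<in> ?V. p z \<in> J}" for J
  have P: "finite (P J)" "P J \<subseteq> ?V" for J
    using V by (auto simp: P_def)
  define r where "r z = (if z = w then u else z)" for z
  have E: "\<exists>z0 z0'. circ k (p z0) (p z0') \<and> z0 \<in> ?V \<and> z0' \<in> ?V \<and>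
      z = r z0 \<and> z' = r z0' \<and> z \<noteq> z'"
    if "(z, z') \<in> ?E" for z z'
  proof -
    have "?E = {(r x, r y) | x y. (x, y) \<in> parcs (andrasfai k) \<and> r x \<noteq> r y}"
      by (simp add: contract_edge_def r_def[abs_def] Let_def)
    then obtain z0 z0' where z: "(z0, z0') \<in> parcs (andrasfai k)" "z = r z0" "z' = r z0'" "z \<noteq> z'"
      using \<open>(z, z') \<in> ?E\<close> by auto
    moreover have "z0 \<in> ?V" "z0' \<in> ?V"
      using pair_graph_andrasfai[of k] z(1) by (auto simp: pair_graph_iff)
    ultimately show ?thesis using coords_arc[OF p] by blast
  qed
  show ?thesis
  proof (cases "p y = k")
    case True
    have uw: "p u = 0 \<and> p w = k \<or> p u = k \<and> p w = 0" using xy y(1) True by auto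
    \<comment> \<open>The arc from 0 to k with its ends merged; the merged vertex is called
      \<open>u\<close>, whichever end is at 0.\<close>
    let ?S = "insert u (P {0<..<k})"
    have "(z, z') \<notin> ?E" if "z \<in> ?S" "z' \<in> ?S" for z z'
    proof
      assume "(z, z') \<in> ?E"
      then obtain z0 z0' where z: "circ k (p z0) (p z0')" "z0 \<in> ?V" "z0' \<in> ?V"
        "z = r z0" "z' = r z0'" "z \<noteq> z'"
        using E by blast
      have "z0 \<in> {u, w} \<or> 0 < p z0 \<and> p z0 < k" "z0' \<in> {u, w} \<or> 0 < p z0' \<and> p z0' < k"
        using z(4,5) that by (auto simp: P_def r_def split: if_splits)
      moreover have "z0 \<in> {u, w} \<Longrightarrow> z = u" "z0' \<in> {u, w} \<Longrightarrow> z' = u"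
        using z(4,5) by (auto simp: r_def)
      ultimately show False using z(1,6) uw unfolding circ_def by auto
    qed
    then have "td_le ?E 1 ?S"
      using P by (intro td_le_independent) auto
    moreover have "?S \<subseteq> ?V - {w}"
      using P xV xy uw assms(1) by (auto simp: P_def)
    moreover have "v = u" if "v \<in> ?S"
      using that v True by (auto simp: P_def)
    moreover have "card (P {0<..<k}) = k - 1"
    proof -
      have "{0<..<k} \<subseteq> {..<3 * k - 1}" by auto
      then have "card (P {0<..<k}) = card {0<..<k}" unfolding P_def by (rule coords_card[OF p])
      then show ?thesis by simp
    qed
    moreover have "u \<notin> P {0<..<k}" using uw by (auto simp: P_def)
    ultimately show ?thesis using that[of ?S] P(1) assms(1) by simp
  next
    case False
    then have t: "k < p y" using y by simp
    \<comment> \<open>This arc stops before \<open>p y\<close>, so it avoids the merged vertex and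
      keeps its original adjacencies.\<close>
    let ?S = "P {0<..k}"
    have uw: "u \<notin> ?S" "w \<notin> ?S" using xy y(1) t by (auto simp: P_def)
    have "(z, z') \<notin> ?E" if "z \<in> ?S" "z' \<in> ?S" for z z'
    proof
      assume "(z, z') \<in> ?E"
      then obtain z0 z0' where z: "circ k (p z0) (p z0')"
        "z = r z0" "z' = r z0'"
        using E by blast
      then have "z0 = z" "z0' = z'" using that uw by (auto simp: r_def split: if_splits)
      then show False using z(1) that by (auto simp: P_def circ_def)
    qed
    then have "td_le ?E 1 ?S"
      using P by (intro td_le_independent) auto
    moreover have "v \<notin> ?S"
      using v t by (auto simp: P_def)
    moreover have "card ?S = k"
    proof -
      have "{0<..k} \<subseteq> {..<3 * k - 1}" using coords_less[OF p xV(2)] t by auto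
      then have "card ?S = card {0<..k}" unfolding P_def by (rule coords_card[OF p])
      then show ?thesis by simp
    qed
    ultimately show ?thesis using that[of ?S] P(2) uw by blast
  qed
qed

section \<open>Criticality of And(k) and And(k) - v\<close>

lemma pverts_delete_vertex [simp]: "pverts (delete_vertex G v) = pverts G - {v}"
  by (simp add: delete_vertex_def)

lemma parcs_delete_vertex: "parcs (delete_vertex G v) \<subseteq> parcs G"
  by (auto simp: delete_vertex_def)

lemma not_td_le_andrasfai:
  assumes "k \<ge> 1"
  shows "\<not> td_le (parcs (andrasfai k)) (2 * k - 1) (pverts (andrasfai k))"
proof
  assume "td_le (parcs (andrasfai k)) (2 * k - 1) (pverts (andrasfai k))"
  from td_le_andrasfai_card[OF this assms, of "{}"] show False
    using assms by (simp add: pverts_andrasfai)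
qed

lemma critical_andrasfai:
  assumes "k \<ge> 1"
  shows "critical (andrasfai k)"
proof (rule criticalI[OF pair_graph_andrasfai not_td_le_andrasfai[OF assms]])
  let ?V = "pverts (andrasfai k)"
  have V: "finite ?V" "card ?V = 3 * k - 1"
    using pverts_andrasfai[OF assms] by simp_all
  have sub: "a \<in> ?V" "b \<in> ?V" if "(a, b) \<in> parcs (andrasfai k)" for a b
    using that pair_graph_andrasfai[of k] by (auto simp: pair_graph_iff)
  fix H assume "minor_step (andrasfai k) H"
  then show "td_le (parcs H) (2 * k - 1) (pverts H)"
  proof cases
    case (del_vertex w)
    have "0 \<in> ?V" "1 \<in> ?V" using assms pverts_andrasfai[OF assms] by auto
    \<comment> \<open>An auxiliary second vertex: the bound for two deleted vertices applies, and
      putting \<open>v\<close> back costs one level.\<close>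
    then obtain v where v: "v \<in> ?V" "v \<noteq> w" by (metis zero_neq_one)
    have "td_le (parcs (andrasfai k)) (Suc (2 * k - 2)) (insert v (?V - {v, w}))"
      using td_le_delete_two_vertices[OF assms v(1) del_vertex(2) v(2)] by (rule td_le.insert)
    moreover have "insert v (?V - {v, w}) = ?V - {w}" using v by auto
    moreover have "Suc (2 * k - 2) = 2 * k - 1" using assms by linarith
    ultimately have "td_le (parcs (andrasfai k)) (2 * k - 1) (?V - {w})" by simp
    then show ?thesis
      by (rule td_le_subset) (auto simp: del_vertex(1) delete_vertex_def)
  next
    case (del_edge a b)
    obtain j S where S: "td_le (parcs (andrasfai k) - {(a, b), (b, a)}) j S" "S \<subseteq> ?V" "card S = k + j"
      using td_le_delete_edge[OF assms del_edge(2) sub(1)[OF del_edge(2)]] by blast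
    then have "td_le (parcs (andrasfai k) - {(a, b), (b, a)}) (2 * k - 1) ?V"
      using V by (intro td_le_extend[OF S(1,2)]) auto
    then show ?thesis by (simp add: del_edge(1) delete_edge_def)
  next
    case (contract u w)
    obtain S where S: "td_le (parcs (contract_edge (andrasfai k) u w)) 1 S" "S \<subseteq> ?V - {w}" "card S = k"
      using td_le_contract_edge[OF assms contract(2) sub(1)[OF contract(2)]] by blast
    have "td_le (parcs (contract_edge (andrasfai k) u w)) (2 * k - 1) (?V - {w})"
      using V S(3) sub(2)[OF contract(2)] assms by (intro td_le_extend[OF S(1,2)]) auto
    then show ?thesis by (simp add: contract(1) contract_edge_def Let_def)
  qed
qed

lemma critical_andrasfai_delete_vertex:
  assumes "k \<ge> 1" "v \<in> pverts (andrasfai k)"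
  shows "critical (delete_vertex (andrasfai k) v)"
proof (rule criticalI)
  let ?V = "pverts (andrasfai k)" and ?G = "delete_vertex (andrasfai k) v"
  have V: "finite ?V" "card ?V = 3 * k - 1"
    using pverts_andrasfai[OF assms(1)] by simp_all
  have card: "card (?V - {v}) = 3 * k - 2" using V assms(2) by simp
  show "pair_graph ?G"
    using minor_step.del_vertex[OF assms(2)] pair_graph_andrasfai by (rule pair_graph_minor_step)
  show "\<not> td_le (parcs ?G) (2 * k - 2) (pverts ?G)"
  proof
    assume "td_le (parcs ?G) (2 * k - 2) (pverts ?G)"
    then have "td_le (parcs (andrasfai k)) (2 * k - 2) (?V - {v})"
      by (rule td_le_subset) (auto simp: delete_vertex_def)
    \<comment> \<open>Putting \<open>v\<close> back costs only one level, which would contradict the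
      lower bound for And(k).\<close>
    then have "td_le (parcs (andrasfai k)) (Suc (2 * k - 2)) (insert v (?V - {v}))"
      by (rule td_le.insert)
    moreover have "insert v (?V - {v}) = ?V" using assms(2) by auto
    moreover have "Suc (2 * k - 2) = 2 * k - 1" using assms(1) by linarith
    ultimately show False using not_td_le_andrasfai[OF assms(1)] by simp
  qed
  have sub: "(a, b) \<in> parcs (andrasfai k)" "a \<in> ?V - {v}" "b \<in> ?V - {v}" if "(a, b) \<in> parcs ?G" for a b
    using that pair_graph_andrasfai[of k] by (auto simp: pair_graph_iff delete_vertex_def)
  fix H assume "minor_step ?G H"
  then show "td_le (parcs H) (2 * k - 2) (pverts H)"
  proof cases
    case (del_vertex w)
    then have "td_le (parcs (andrasfai k)) (2 * k - 2) (?V - {v, w})"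
      using assms by (intro td_le_delete_two_vertices) auto
    then show ?thesis
      by (rule td_le_subset) (auto simp: del_vertex(1) delete_vertex_def)
  next
    case (del_edge a b)
    note ab = sub[OF del_edge(2)]
    obtain j S where S: "td_le (parcs (andrasfai k) - {(a, b), (b, a)}) j S" "S \<subseteq> ?V"
      "v \<in> S \<Longrightarrow> v \<in> {a, b}" "card S = k + j"
      using td_le_delete_edge[OF assms(1) ab(1) assms(2)] by blast
    have "S \<subseteq> ?V - {v}" using S(2,3) ab by auto
    then have "td_le (parcs (andrasfai k) - {(a, b), (b, a)}) (2 * k - 2) (?V - {v})"
      using V(1) card S(4) assms(1) by (intro td_le_extend[OF S(1)]) auto
    then show ?thesis
      by (rule td_le_subset) (auto simp: del_edge(1) delete_edge_def delete_vertex_def)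
  next
    case (contract u w)
    note uw = sub[OF contract(2)]
    obtain S where S: "td_le (parcs (contract_edge (andrasfai k) u w)) 1 S" "S \<subseteq> ?V - {w}"
      "v \<in> S \<Longrightarrow> v = u" "card S = k"
      using td_le_contract_edge[OF assms(1) uw(1) assms(2)] by blast
    have "card (?V - {v} - {w}) = 3 * k - 3" using card V(1) uw by simp
    moreover have "S \<subseteq> ?V - {v} - {w}" using S(2,3) uw by auto
    ultimately have "td_le (parcs (contract_edge (andrasfai k) u w)) (2 * k - 2) (?V - {v} - {w})"
      using V(1) S(4) assms(1) by (intro td_le_extend[OF S(1)]) auto
    then show ?thesis
    proof (rule td_le_subset)
      show "pverts H \<subseteq> ?V - {v} - {w}"
        by (auto simp: contract(1) contract_edge_def Let_def)
      \<comment> \<open>Contracting after the deletion of \<open>v\<close> produces no arc that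
        contraction in And(k) lacks.\<close>
      have "parcs H \<subseteq> parcs (contract_edge (andrasfai k) u w)"
        unfolding contract(1) contract_edge_def Let_def pair_pre_digraph.simps
        using parcs_delete_vertex[of "andrasfai k" v] by blast
      then show "parcs H \<inter> pverts H \<times> pverts H \<subseteq> parcs (contract_edge (andrasfai k) u w)"
        by blast
    qed
  qed
qed

theorem theorem4p5:
  fixes k v :: nat
  assumes "k \<ge> 1"
    and "v \<in> pverts (andrasfai k)"
  shows "critical (andrasfai k) \<and> critical (delete_vertex (andrasfai k) v)"
  using assms critical_andrasfai critical_andrasfai_delete_vertex by blast

end
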